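(* Let $n\ge1$ and let $\alpha\in\mathcal{CT}_n$. Then $\alpha$ is a regular element of $\mathcal{CT}_n$ if and only if the partition $\mathbf{Ker}\,\alpha$ has a convex transversal.
   Context: $[n]=\{1,\ldots,n\}$. $\mathcal{CT}_n$ is the semigroup, under composition, of all maps $\alpha:[n]\to[n]$ with $|x\alpha-y\alpha|\le|x-y|$ for all $x,y\in[n]$ (maps written on the right). $\mathbf{Ker}\,\alpha$ is the partition of $[n]$ into the classes of $\ker\alpha=\{(x,y):x\alpha=y\alpha\}$. A transversal of a partition is a set meeting each block in exactly one element; a subset of $[n]$ is convex if it contains every element of $[n]$ lying between any two of its elements. An element $a$ of a semigroup $S$ is regular if $a=aba$ for some $b\in S$. *)

theory Defs
  imports "HOL-Algebra.Group"
begin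

text \<open>Maps on \<open>[n]\<close> are extensional functions on \<open>{1..n}\<close>. Maps are written on the right, so the
  product of \<open>\<alpha>\<close> and \<open>\<beta>\<close> applies \<open>\<alpha>\<close> first. Distances are taken in \<open>int\<close> because subtraction
  on \<open>nat\<close> truncates.\<close>

definition CT :: "nat \<Rightarrow> (nat \<Rightarrow> nat) monoid" where
  "CT n = \<lparr>carrier = {\<alpha> \<in> {1..n} \<rightarrow>\<^sub>E {1..n}.
              \<forall>x\<in>{1..n}. \<forall>y\<in>{1..n}. \<bar>int (\<alpha> x) - int (\<alpha> y)\<bar> \<le> \<bar>int x - int y\<bar>},
           monoid.mult = (\<lambda>\<alpha> \<beta>. compose {1..n} \<beta> \<alpha>),
           one = (\<lambda>x\<in>{1..n}. x)\<rparr>"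

definition regular_element :: "('a, 'b) monoid_scheme \<Rightarrow> 'a \<Rightarrow> bool" where
  "regular_element S a \<longleftrightarrow> a \<in> carrier S \<and> (\<exists>b\<in>carrier S. a = a \<otimes>\<^bsub>S\<^esub> b \<otimes>\<^bsub>S\<^esub> a)"

definition ker_rel :: "nat \<Rightarrow> (nat \<Rightarrow> nat) \<Rightarrow> (nat \<times> nat) set" where
  "ker_rel n \<alpha> = {(x, y). x \<in> {1..n} \<and> y \<in> {1..n} \<and> \<alpha> x = \<alpha> y}"

definition Ker :: "nat \<Rightarrow> (nat \<Rightarrow> nat) \<Rightarrow> nat set set" where
  "Ker n \<alpha> = {1..n} // ker_rel n \<alpha>"

definition transversal :: "'a set set \<Rightarrow> 'a set \<Rightarrow> bool" where
  "transversal P T \<longleftrightarrow> T \<subseteq> \<Union>P \<and> (\<forall>B\<in>P. \<exists>!x. x \<in> T \<inter> B)"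

definition convex_subset :: "nat \<Rightarrow> nat set \<Rightarrow> bool" where
  "convex_subset n T \<longleftrightarrow>
     T \<subseteq> {1..n} \<and> (\<forall>x\<in>T. \<forall>y\<in>T. \<forall>z\<in>{1..n}. x \<le> z \<and> z \<le> y \<longrightarrow> z \<in> T)"

lemma monoid_CT: "monoid (CT n)"
proof (rule monoidI)
  fix \<alpha> \<beta> assume a: "\<alpha> \<in> carrier (CT n)" and b: "\<beta> \<in> carrier (CT n)"
  have "\<bar>int (\<beta> (\<alpha> x)) - int (\<beta> (\<alpha> y))\<bar> \<le> \<bar>int x - int y\<bar>"
    if "x \<in> {1..n}" "y \<in> {1..n}" for x y
  proof -
    have "\<alpha> x \<in> {1..n}" "\<alpha> y \<in> {1..n}"
      using a that by (auto simp only: CT_def partial_object.simps mem_Collect_eq PiE_mem)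
    then have "\<bar>int (\<beta> (\<alpha> x)) - int (\<beta> (\<alpha> y))\<bar> \<le> \<bar>int (\<alpha> x) - int (\<alpha> y)\<bar>"
      using b by (simp add: CT_def)
    also have "\<dots> \<le> \<bar>int x - int y\<bar>"
      using a that by (simp add: CT_def)
    finally show ?thesis .
  qed
  moreover have "compose {1..n} \<beta> \<alpha> \<in> {1..n} \<rightarrow>\<^sub>E {1..n}"
    using a b by (auto simp: CT_def compose_def PiE_iff Pi_iff)
  ultimately show "\<alpha> \<otimes>\<^bsub>CT n\<^esub> \<beta> \<in> carrier (CT n)"
    by (simp add: CT_def compose_def)
next
  fix \<alpha> \<beta> \<gamma> assume "\<alpha> \<in> carrier (CT n)"
  then show "\<alpha> \<otimes>\<^bsub>CT n\<^esub> \<beta> \<otimes>\<^bsub>CT n\<^esub> \<gamma> = \<alpha> \<otimes>\<^bsub>CT n\<^esub> (\<beta> \<otimes>\<^bsub>CT n\<^esub> \<gamma>)"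
    by (auto simp: CT_def compose_def PiE_iff Pi_iff fun_eq_iff)
qed (auto simp: CT_def compose_def PiE_iff Pi_iff fun_eq_iff extensional_def)

lemma equiv_ker_rel: "equiv {1..n} (ker_rel n \<alpha>)"
  by (auto simp: ker_rel_def intro!: equivI refl_onI symI transI)

end

theory Submission
  imports Defs
begin

text \<open>A transversal of \<open>Ker \<alpha>\<close> is a set that \<open>\<alpha>\<close> maps bijectively onto its image, and contractions
  map convex sets to convex sets. If \<open>\<alpha> = \<alpha>\<beta>\<alpha>\<close>, then \<open>\<beta>\<close> maps the image of \<open>\<alpha>\<close> onto a convex
  transversal. Conversely, a contraction that is injective on a convex set is an isometry there, so
  the inverse of \<open>\<alpha>\<close> restricted to a convex transversal is a contraction on the interval \<open>im \<alpha>\<close>;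
  precomposing it with the retraction of \<open>[n]\<close> onto this interval gives \<open>\<beta>\<close>.\<close>

lemma CT_carrier_iff:
  "\<alpha> \<in> carrier (CT n) \<longleftrightarrow> \<alpha> \<in> {1..n} \<rightarrow>\<^sub>E {1..n} \<and>
     (\<forall>x\<in>{1..n}. \<forall>y\<in>{1..n}. \<bar>int (\<alpha> x) - int (\<alpha> y)\<bar> \<le> \<bar>int x - int y\<bar>)"
  by (simp add: CT_def)

text \<open>Both \<alpha> and the threefold product are extensional on [n], so comparing their
  values there decides whether they are equal.\<close>

lemma regular_element_CT_iff:
  assumes "\<alpha> \<in> carrier (CT n)"
  shows "regular_element (CT n) \<alpha> \<longleftrightarrow>
     (\<exists>\<beta>\<in>carrier (CT n). \<forall>x\<in>{1..n}. \<alpha> (\<beta> (\<alpha> x)) = \<alpha> x)"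
proof -
  have "\<alpha> = \<alpha> \<otimes>\<^bsub>CT n\<^esub> \<beta> \<otimes>\<^bsub>CT n\<^esub> \<alpha> \<longleftrightarrow> (\<forall>x\<in>{1..n}. \<alpha> (\<beta> (\<alpha> x)) = \<alpha> x)" for \<beta>
    using assms by (auto simp: CT_def compose_def fun_eq_iff PiE_iff extensional_def)
  then show ?thesis
    using assms by (simp add: regular_element_def)
qed

text \<open>The blocks are the fibres of \<alpha> over the points of its image. A point of
  \<open>T\<close> in every fibre means that \<open>T\<close> has the full image; at most one in
  each means injectivity on \<open>T\<close>.\<close>

lemma transversal_Ker_iff:
  "transversal (Ker n \<alpha>) T \<longleftrightarrow> T \<subseteq> {1..n} \<and> inj_on \<alpha> T \<and> \<alpha> ` T = \<alpha> ` {1..n}"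
proof -
  have U: "\<Union>(Ker n \<alpha>) = {1..n}"
    unfolding Ker_def by (rule Union_quotient[OF equiv_ker_rel])
  have "Ker n \<alpha> = (\<lambda>x. {y \<in> {1..n}. \<alpha> x = \<alpha> y}) ` {1..n}"
    unfolding Ker_def quotient_def ker_rel_def by auto
  then have B: "(\<forall>B\<in>Ker n \<alpha>. \<exists>!y. y \<in> T \<inter> B) \<longleftrightarrow>
      (\<forall>x\<in>{1..n}. \<exists>!y. y \<in> T \<and> y \<in> {1..n} \<and> \<alpha> x = \<alpha> y)"
    by simp
  show ?thesis
  proof (cases "T \<subseteq> {1..n}")
    case True
    have "(\<forall>x\<in>{1..n}. \<exists>!y. y \<in> T \<and> y \<in> {1..n} \<and> \<alpha> x = \<alpha> y) \<longleftrightarrow>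
        inj_on \<alpha> T \<and> \<alpha> ` T = \<alpha> ` {1..n}" (is "?L \<longleftrightarrow> ?R")
    proof
      assume L: ?L
      have "inj_on \<alpha> T"
        using L True by (intro inj_onI) (metis subsetD)
      moreover have "\<alpha> ` {1..n} \<subseteq> \<alpha> ` T"
        using L by blast
      ultimately show ?R using True by blast
    next
      assume R: ?R
      show ?L
      proof
        fix x assume "x \<in> {1..n}"
        then obtain y where "y \<in> T" "\<alpha> x = \<alpha> y" using R by (metis imageE imageI)
        moreover from this have "y \<in> {1..n}" using True by blast
        ultimately show "\<exists>!y. y \<in> T \<and> y \<in> {1..n} \<and> \<alpha> x = \<alpha> y"
          using R by (intro ex1I[of _ y]) (auto dest: inj_onD)
      qed
    qed
    then show ?thesis by (simp only: transversal_def U B True simp_thms)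
  qed (simp add: transversal_def U)
qed

lemma contraction_intermediate_value:
  fixes f :: "nat \<Rightarrow> nat"
  assumes step: "\<And>i. a \<le> i \<Longrightarrow> i < b \<Longrightarrow> \<bar>int (f (Suc i)) - int (f i)\<bar> \<le> 1"
    and "a \<le> b" and between: "f a \<le> w \<and> w \<le> f b \<or> f b \<le> w \<and> w \<le> f a"
  shows "\<exists>i\<in>{a..b}. f i = w"
  using between
proof
  assume "f a \<le> w \<and> w \<le> f b"
  then show ?thesis
    using nat_intermed_int_val[of a b "\<lambda>i. int (f i)" "int w"] step \<open>a \<le> b\<close> by auto
next
  assume "f b \<le> w \<and> w \<le> f a"
  \<comment> \<open>Negating \<open>f\<close> turns the descending case into the ascending
    one.\<close>
  moreover have "\<bar>- int (f (Suc i)) - - int (f i)\<bar> \<le> 1" if "a \<le> i" "i < b" for i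
    using step[OF that] by linarith
  ultimately show ?thesis
    using nat_intermed_int_val[of a b "\<lambda>i. - int (f i)" "- int w"] \<open>a \<le> b\<close> by auto
qed

text \<open>Neighbouring points have images at most 1 apart, so \<alpha> cannot jump over a value
  between two of its values.\<close>

lemma convex_subset_image:
  assumes \<alpha>: "\<alpha> \<in> carrier (CT n)" and S: "convex_subset n S"
  shows "convex_subset n (\<alpha> ` S)"
  unfolding convex_subset_def
proof (intro conjI ballI impI)
  have Sn: "S \<subseteq> {1..n}" using S by (simp add: convex_subset_def)
  then show "\<alpha> ` S \<subseteq> {1..n}"
    using \<alpha> unfolding CT_carrier_iff by auto
  fix p q w
  assume p: "p \<in> \<alpha> ` S" and q: "q \<in> \<alpha> ` S" and w: "p \<le> w \<and> w \<le> q"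
  obtain u v where u: "u \<in> S" "p = \<alpha> u" and v: "v \<in> S" "q = \<alpha> v"
    using p q by auto
  \<comment> \<open>Since \<alpha> need not be monotone, the preimages of \<open>p\<close> \<le>
    \<open>q\<close> may come in either order.\<close>
  define a b where "a = min u v" and "b = max u v"
  have ab: "a \<in> S" "b \<in> S" "a \<le> b"
    using u v by (auto simp: a_def b_def min_def max_def)
  have sub: "{a..b} \<subseteq> S"
    using S ab unfolding convex_subset_def by fastforce
  have "\<bar>int (\<alpha> (Suc i)) - int (\<alpha> i)\<bar> \<le> 1" if "a \<le> i" "i < b" for i
  proof -
    have "i \<in> {1..n}" "Suc i \<in> {1..n}"
      using that sub Sn by (auto simp: subset_iff)
    then have "\<bar>int (\<alpha> (Suc i)) - int (\<alpha> i)\<bar> \<le> \<bar>int (Suc i) - int i\<bar>"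
      using \<alpha> unfolding CT_carrier_iff by blast
    then show ?thesis by simp
  qed
  moreover have "\<alpha> a \<le> w \<and> w \<le> \<alpha> b \<or> \<alpha> b \<le> w \<and> w \<le> \<alpha> a"
    using u v w by (auto simp: a_def b_def min_def max_def)
  ultimately have "\<exists>i\<in>{a..b}. \<alpha> i = w"
    using \<open>a \<le> b\<close> by (intro contraction_intermediate_value)
  then show "w \<in> \<alpha> ` S" using sub by auto
qed

text \<open>By injectivity each step is 1 or -1, and a change of sign would return to the value
  taken two places earlier. Hence \<open>f\<close> is affine with slope 1 or -1.\<close>

lemma injective_steps_isometry:
  fixes f :: "nat \<Rightarrow> int"
  assumes step: "\<And>i. a \<le> i \<Longrightarrow> i < b \<Longrightarrow> \<bar>f (Suc i) - f i\<bar> \<le> 1"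
    and inj: "inj_on f {a..b}" and "a \<le> b"
  shows "\<bar>f b - f a\<bar> = int b - int a"
proof -
  \<comment> \<open>The induction carries the affine formula on the whole interval, because the next
    step must be compared with the slope of the previous ones.\<close>
  have "\<exists>s\<in>{1, -1}. \<forall>i\<in>{a..b}. f i = f a + s * (int i - int a)"
    using \<open>a \<le> b\<close> step inj
  proof (induction b rule: dec_induct)
    case base
    then show ?case by auto
  next
    case (step m)
    have "inj_on f {a..m}"
      by (rule inj_on_subset[OF step.prems(2)]) auto
    moreover have "\<bar>f (Suc i) - f i\<bar> \<le> 1" if "a \<le> i" "i < m" for i
      using that by (intro step.prems(1)) auto
    ultimately obtain s where s: "s \<in> {1, -1::int}"
      and lin: "\<forall>i\<in>{a..m}. f i = f a + s * (int i - int a)"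
      using step.IH by blast
    have "f (Suc m) \<noteq> f m"
      using step.prems(2) step.hyps by (auto dest!: inj_onD)
    moreover have "\<bar>f (Suc m) - f m\<bar> \<le> 1"
      using step by auto
    ultimately have d: "f (Suc m) = f m + 1 \<or> f (Suc m) = f m - 1"
      by linarith
    show ?case
    proof (cases "m = a")
      \<comment> \<open>On a single point either sign satisfies the induction hypothesis, so the
        slope is chosen afresh from the first step.\<close>
      case True
      have "\<forall>i\<in>{a..Suc m}. i = a \<or> i = Suc a" using True by auto
      then show ?thesis using d True by auto
    next
      case False
      \<comment> \<open>Here \<open>m - 1\<close> still lies in the interval, and this inequality
        excludes the step \<open>- s\<close>.\<close>
      then have "f (Suc m) \<noteq> f (m - 1)"
        using step.prems(2) step.hyps by (auto dest!: inj_onD)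
      moreover have "f (m - 1) = f a + s * (int m - 1 - int a)" "f m = f a + s * (int m - int a)"
        using lin[rule_format, of "m - 1"] lin[rule_format, of m] False step.hyps
        by (auto simp: of_nat_diff)
      ultimately have "f (Suc m) = f a + s * (int (Suc m) - int a)"
        using s d by auto
      then have "\<forall>i\<in>{a..Suc m}. f i = f a + s * (int i - int a)"
        using lin by (metis atLeastAtMost_iff le_Suc_eq)
      then show ?thesis using s by blast
    qed
  qed
  then obtain s where "s \<in> {1, -1}" "f b = f a + s * (int b - int a)"
    using \<open>a \<le> b\<close> by (meson atLeastAtMost_iff order_refl)
  then show ?thesis using \<open>a \<le> b\<close> by auto
qed

text \<open>Convexity keeps the whole interval between \<open>x\<close> and \<open>y\<close> inside
  \<open>T\<close>, so \<alpha> is injective along every unit step from one to the other.\<close>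

lemma isometry_on_convex:
  assumes \<alpha>: "\<alpha> \<in> carrier (CT n)" and T: "convex_subset n T" and inj: "inj_on \<alpha> T"
    and "x \<in> T" "y \<in> T"
  shows "\<bar>int (\<alpha> x) - int (\<alpha> y)\<bar> = \<bar>int x - int y\<bar>"
proof -
  have *: "\<bar>int (\<alpha> b) - int (\<alpha> a)\<bar> = int b - int a" if ab: "a \<in> T" "b \<in> T" "a \<le> b" for a b
  proof (rule injective_steps_isometry)
    have Tn: "T \<subseteq> {1..n}" using T by (simp add: convex_subset_def)
    have sub: "{a..b} \<subseteq> T"
      using T ab unfolding convex_subset_def by fastforce
    then show "inj_on (\<lambda>i. int (\<alpha> i)) {a..b}"
      using inj by (auto simp: inj_on_def)
    fix i assume "a \<le> i" "i < b"
    then have "i \<in> {1..n}" "Suc i \<in> {1..n}"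
      using sub Tn by (auto simp: subset_iff)
    then have "\<bar>int (\<alpha> (Suc i)) - int (\<alpha> i)\<bar> \<le> \<bar>int (Suc i) - int i\<bar>"
      using \<alpha> unfolding CT_carrier_iff by blast
    then show "\<bar>int (\<alpha> (Suc i)) - int (\<alpha> i)\<bar> \<le> 1" by simp
  qed (use ab in simp)
  show ?thesis
    using *[of x y] *[of y x] assms(4,5) by (cases "x \<le> y") auto
qed

lemma regular_imp_convex_transversal:
  assumes \<alpha>: "\<alpha> \<in> carrier (CT n)" and "regular_element (CT n) \<alpha>"
  shows "\<exists>T. transversal (Ker n \<alpha>) T \<and> convex_subset n T"
proof -
  obtain \<beta> where \<beta>: "\<beta> \<in> carrier (CT n)"
    and reg: "\<forall>x\<in>{1..n}. \<alpha> (\<beta> (\<alpha> x)) = \<alpha> x"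
    using assms regular_element_CT_iff[OF \<alpha>] by blast
  let ?T = "\<beta> ` \<alpha> ` {1..n}"
  have "convex_subset n {1..n}" by (simp add: convex_subset_def)
  then have conv: "convex_subset n ?T"
    using \<alpha> \<beta> by (intro convex_subset_image)
  \<comment> \<open>On the image of \<alpha>, applying \<beta> and then \<alpha> is the identity, so
    a point \<beta> v of \<open>?T\<close> is determined by its value v under \<alpha>.\<close>
  moreover have "inj_on \<alpha> ?T" using reg by (auto simp: inj_on_def)
  moreover have "\<alpha> ` ?T = \<alpha> ` {1..n}"
    unfolding image_image using reg by (intro image_cong) auto
  ultimately have "transversal (Ker n \<alpha>) ?T"
    unfolding transversal_Ker_iff convex_subset_def by blast
  with conv show ?thesis by blast
qed

lemma convex_transversal_imp_regular:
  assumes n: "n \<ge> 1" and \<alpha>: "\<alpha> \<in> carrier (CT n)"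
    and trans: "transversal (Ker n \<alpha>) T" and conv: "convex_subset n T"
  shows "regular_element (CT n) \<alpha>"
proof -
  let ?I = "\<alpha> ` {1..n}"
  have Tn: "T \<subseteq> {1..n}" and inj: "inj_on \<alpha> T" and im: "\<alpha> ` T = ?I"
    using trans by (auto simp: transversal_Ker_iff)
  have In: "?I \<subseteq> {1..n}" using \<alpha> unfolding CT_carrier_iff by auto
  have "convex_subset n ?I"
    using \<alpha> by (intro convex_subset_image) (simp_all add: convex_subset_def)
  define c d where "c = Min ?I" and "d = Max ?I"
  \<comment> \<open>Since \<open>n\<close> \<ge> 1 the image is nonempty, so \<open>Min\<close> and
    \<open>Max\<close> are attained.\<close>
  have fin: "finite ?I" "?I \<noteq> {}" using n by auto
  then have I: "c \<in> ?I" "d \<in> ?I"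
    unfolding c_def d_def by (rule Min_in, rule Max_in)
  have bounds: "c \<le> v \<and> v \<le> d" if "v \<in> ?I" for v
    unfolding c_def d_def using fin that by (intro conjI Min_le Max_ge)
  \<comment> \<open>Clamping to the interval from \<open>c\<close> to \<open>d\<close>, which is all
    of \<open>?I\<close> by convexity: a contraction that fixes \<open>?I\<close> pointwise.\<close>
  define r where "r = (\<lambda>x. max c (min d x))"
  have r_in: "r x \<in> ?I" for x
  proof -
    have "c \<le> r x" "r x \<le> d" using bounds[OF I(1)] by (auto simp: r_def)
    moreover from this have "r x \<in> {1..n}"
      using subsetD[OF In I(1)] subsetD[OF In I(2)] by auto
    ultimately show ?thesis
      using \<open>convex_subset n ?I\<close> I unfolding convex_subset_def by blast
  qed
  have r_id: "r v = v" if "v \<in> ?I" for v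
    using bounds[OF that] by (simp add: r_def)
  have r_contr: "\<bar>int (r x) - int (r y)\<bar> \<le> \<bar>int x - int y\<bar>" for x y
    unfolding r_def by (simp add: max_def min_def)
  define g where "g = inv_into T \<alpha>"
  have g_in: "g v \<in> T" and \<alpha>_g: "\<alpha> (g v) = v" if "v \<in> ?I" for v
    using that im by (auto simp: g_def inv_into_into f_inv_into_f)
  define \<beta> where "\<beta> = (\<lambda>x\<in>{1..n}. g (r x))"
  \<comment> \<open>Both \<open>g (r x)\<close> and \<open>g (r y)\<close> lie in \<open>T\<close>,
    where \<alpha> preserves distances, so they are exactly as far apart as \<open>r x\<close> and
    \<open>r y\<close>.\<close>
  have "\<bar>int (g (r x)) - int (g (r y))\<bar> \<le> \<bar>int x - int y\<bar>" for x y
    using isometry_on_convex[OF \<alpha> conv inj g_in[OF r_in[of x]] g_in[OF r_in[of y]]]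
      r_contr[of x y] by (simp add: \<alpha>_g[OF r_in])
  moreover have "g (r x) \<in> {1..n}" for x
    using g_in[OF r_in] Tn by blast
  ultimately have "\<beta> \<in> carrier (CT n)"
    unfolding CT_carrier_iff by (auto simp: \<beta>_def)
  moreover have "\<alpha> (\<beta> (\<alpha> x)) = \<alpha> x" if "x \<in> {1..n}" for x
  proof -
    have v: "\<alpha> x \<in> ?I" using that by simp
    then have "\<beta> (\<alpha> x) = g (\<alpha> x)" using In r_id by (auto simp: \<beta>_def)
    then show ?thesis using \<alpha>_g[OF v] by simp
  qed
  ultimately show ?thesis
    using regular_element_CT_iff[OF \<alpha>] by blast
qed

theorem corollary1p13:
  fixes n :: nat and \<alpha> :: "nat \<Rightarrow> nat"
  assumes "n \<ge> 1"
    and "\<alpha> \<in> carrier (CT n)"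
  shows "regular_element (CT n) \<alpha> \<longleftrightarrow>
         (\<exists>T. transversal (Ker n \<alpha>) T \<and> convex_subset n T)"
  using regular_imp_convex_transversal[OF assms(2)] convex_transversal_imp_regular[OF assms] by iprover

end
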